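(* For every integer $n \geq 0$ and every real $a \neq 0$, $$\int_{0}^{1} (ax+n+1)\,x^{n} e^{ax} \ln x \, dx = e^{a} \sum_{k=0}^{n} (-1)^{k-1} \frac{n!}{(n-k)!\, a^{k+1}} + (-1)^{n} \frac{n!}{a^{n+1}}.$$ *)

theory Defs
  imports "HOL-Analysis.Analysis"
begin

end

theory Submission
  imports Defs "HOL-Real_Asymp.Real_Asymp"
begin

text \<open>
  By the product rule, the integrand plus \<open>x\<^sup>n e\<^bsup>ax\<^esup>\<close> is the derivative of
  \<open>x\<^bsup>n+1\<^esup> e\<^bsup>ax\<^esup> ln x\<close>, which extends continuously by \<open>0\<close> to \<open>x = 0\<close> and vanishes at \<open>x = 1\<close>.
  Hence the integral is minus the integral of \<open>x\<^sup>n e\<^bsup>ax\<^esup>\<close>, whose antiderivative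
  comes from repeated integration by parts.
\<close>

text \<open>The polynomial factor of the antiderivative of \<open>x ^ n * exp (a * x)\<close>. At
  \<open>x = 1\<close> it is minus the sum in the theorem, at \<open>x = 0\<close> the remaining
  term.\<close>

definition power_exp_sum :: "real \<Rightarrow> nat \<Rightarrow> real \<Rightarrow> real" where
  "power_exp_sum a n x =
     (\<Sum>k=0..n. (-1) ^ k * (fact n / (fact (n - k) * a ^ (k + 1))) * x ^ (n - k))"

text \<open>One integration by parts in closed form: split off \<open>k = 0\<close> and shift the
  index. Both later inductions on \<open>n\<close> rest on it.\<close>

lemma power_exp_sum_Suc:
  "power_exp_sum a (Suc n) x = x ^ Suc n / a - real (Suc n) / a * power_exp_sum a n x"
proof -
  have "power_exp_sum a (Suc n) x = x ^ Suc n / a +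
      (\<Sum>k=0..n. (-1) ^ Suc k * (fact (Suc n) / (fact (Suc n - Suc k) * a ^ (Suc k + 1)))
        * x ^ (Suc n - Suc k))"
    unfolding power_exp_sum_def
    by (subst sum.atLeast0_atMost_Suc_shift) simp
  also have "(\<Sum>k=0..n. (-1) ^ Suc k * (fact (Suc n) / (fact (Suc n - Suc k) * a ^ (Suc k + 1)))
        * x ^ (Suc n - Suc k)) = - (real (Suc n) / a * power_exp_sum a n x)"
    unfolding power_exp_sum_def sum_distrib_left sum_negf[symmetric]
    by (intro sum.cong refl) (simp add: mult_ac)
  finally show ?thesis by simp
qed

lemma power_exp_sum_0:
  "power_exp_sum a n 0 = (-1) ^ n * (fact n / a ^ (n + 1))"
  by (induction n) (simp_all add: power_exp_sum_Suc, simp add: power_exp_sum_def)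

lemma DERIV_power_Suc_exp:
  "((\<lambda>x. x ^ Suc n * exp (a * x)) has_real_derivative (a * x + real n + 1) * x ^ n * exp (a * x)) (at x)"
proof -
  have "((\<lambda>x. exp (a * x)) has_real_derivative a * exp (a * x)) (at x)"
    by (auto intro!: derivative_eq_intros)
  from DERIV_mult[OF DERIV_pow[of "Suc n"] this] show ?thesis
    by (rule DERIV_cong) (simp add: algebra_simps)
qed

text \<open>Differentiating \<open>x ^ Suc n * exp (a * x) / a\<close> leaves the excess
  \<open>Suc n / a * x ^ n * exp (a * x)\<close>, which the induction hypothesis cancels.\<close>

lemma DERIV_power_exp_sum:
  assumes "a \<noteq> 0"
  shows "((\<lambda>x. exp (a * x) * power_exp_sum a n x) has_real_derivative x ^ n * exp (a * x)) (at x)"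
proof (induction n)
  case 0
  show ?case
    using assms by (auto simp: power_exp_sum_def intro!: derivative_eq_intros)
next
  case (Suc n)
  have "((\<lambda>x. x ^ Suc n * exp (a * x) / a - real (Suc n) / a * (exp (a * x) * power_exp_sum a n x))
      has_real_derivative x ^ Suc n * exp (a * x)) (at x)"
    by (rule DERIV_cong[OF DERIV_diff[OF DERIV_cdivide[OF DERIV_power_Suc_exp] DERIV_cmult[OF Suc.IH]]])
      (use assms in \<open>simp add: field_simps\<close>)
  then show ?case
    by (simp add: power_exp_sum_Suc algebra_simps)
qed

lemma continuous_on_mult_ln:
  "continuous_on {0..} (\<lambda>x::real. x * ln x)"
  unfolding continuous_on
proof
  fix x :: real
  assume "x \<in> {0..}"
  then consider "x = 0" | "x > 0" by force
  then show "((\<lambda>x. x * ln x) \<longlongrightarrow> x * ln x) (at x within {0..})"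
  proof cases
    case 1
    have "((\<lambda>x::real. x * ln x) \<longlongrightarrow> 0) (at_right 0)"
      by real_asymp
    then show ?thesis
      using 1 by (simp add: at_within_Ici_at_right)
  qed (auto intro!: tendsto_intros)
qed

theorem mainTheorem1:
  fixes n :: nat and a :: real
  assumes "a \<noteq> 0"
  shows "((\<lambda>x::real. (a * x + real n + 1) * x ^ n * exp (a * x) * ln x) has_integral
           (exp a * (\<Sum>k=0..n. (-1) powi (int k - 1) * (fact n / (fact (n - k) * a ^ (k + 1))))
            + (-1) ^ n * (fact n / a ^ (n + 1)))) {0..1}"
proof -
  \<comment> \<open>One factor \<open>x\<close> stays with \<open>ln x\<close>, so that continuity
    at 0 follows from that of \<open>x * ln x\<close> even for \<open>n = 0\<close>.\<close>
  define F where "F x = x ^ n * exp (a * x) * (x * ln x) - exp (a * x) * power_exp_sum a n x" for x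
  have "continuous_on {0..1} F"
    unfolding F_def power_exp_sum_def
    by (intro continuous_intros continuous_on_subset[OF continuous_on_mult_ln]) auto
  moreover have "(F has_real_derivative (a * x + real n + 1) * x ^ n * exp (a * x) * ln x) (at x)"
    if "x \<in> {0<..<1}" for x
  proof -
    have "((\<lambda>x. x ^ Suc n * exp (a * x) * ln x - exp (a * x) * power_exp_sum a n x)
        has_real_derivative (a * x + real n + 1) * x ^ n * exp (a * x) * ln x) (at x)"
      by (rule DERIV_cong[OF DERIV_diff[OF DERIV_mult[OF DERIV_power_Suc_exp DERIV_ln]
              DERIV_power_exp_sum[OF assms]]])
        (use that in \<open>simp_all add: field_simps\<close>)
    then show ?thesis
      by (simp add: F_def[abs_def] mult_ac)
  qed
  \<comment> \<open>The interior version asks for derivatives only on the open interval; for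
    \<open>n = 0\<close>, \<open>F\<close> has none at 0.\<close>
  ultimately have "((\<lambda>x. (a * x + real n + 1) * x ^ n * exp (a * x) * ln x)
      has_integral (F 1 - F 0)) {0..1}"
    by (intro fundamental_theorem_of_calculus_interior)
      (auto simp: has_real_derivative_iff_has_vector_derivative)
  \<comment> \<open>The exponent is -1 at \<open>k = 0\<close>, hence \<open>powi\<close>; lowering
    it by one flips each sign.\<close>
  moreover have at_1: "(\<Sum>k=0..n. (-1) powi (int k - 1) * (fact n / (fact (n - k) * a ^ (k + 1)))) =
      - power_exp_sum a n 1"
    by (simp add: power_exp_sum_def power_int_diff flip: sum_negf)
  have "F 1 - F 0 =
      exp a * (\<Sum>k=0..n. (-1) powi (int k - 1) * (fact n / (fact (n - k) * a ^ (k + 1))))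
      + (-1) ^ n * (fact n / a ^ (n + 1))"
    unfolding at_1 by (simp add: F_def power_exp_sum_0)
  ultimately show ?thesis by simp
qed

end
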